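(* For all positive integers $r$ and $t$, $$F(r,t)\leq (t-1)\binom{rt}{r},$$ where $F(r,t)$ is the maximal $z$ such that there exists a $(z,t)$-colored $r$-uniform multi-hypergraph which contains no rainbow matching of size $t$. (Equivalently: if $z>(t-1)\binom{rt}{r}$, then every $(z,t)$-colored $r$-uniform multi-hypergraph contains a rainbow matching of size $t$.)
   Context: An $r$-uniform multi-hypergraph $\mathcal{H}$ is a hypergraph in which every edge is a set of exactly $r$ vertices and repetitions of edges are allowed. A matching is a collection of pairwise disjoint edges. Given a coloring $c:E(\mathcal{H})\rightarrow[z]=\{1,\dots,z\}$ of the edges (different copies of a repeated edge may receive different colors), a rainbow matching in $\mathcal{H}$ is a matching in which no two edges have the same color. The multi-hypergraph $\mathcal{H}$ is $(z,t)$-colored if its edges are colored with $z$ colors and each of the $z$ color classes is a matching of size (exactly) $t$. *)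

theory Defs
  imports Main "HOL-Library.Disjoint_Sets"
begin

text \<open>Members of \<open>edges H\<close> are names of edges, and \<open>ends H e\<close> is the vertex set of the edge
  named \<open>e\<close>. The map \<open>ends H\<close> need not be injective, so a repeated edge has several names, which
  may be colored differently.\<close>

record ('v, 'e) multi_hypergraph =
  verts :: "'v set"
  edges :: "'e set"
  ends :: "'e \<Rightarrow> 'v set"

definition uniform_multi_hypergraph :: "nat \<Rightarrow> ('v, 'e) multi_hypergraph \<Rightarrow> bool" where
  "uniform_multi_hypergraph r H \<longleftrightarrow>
     (\<forall>e\<in>edges H. ends H e \<subseteq> verts H \<and> finite (ends H e) \<and> card (ends H e) = r)"

text \<open>Two copies of the same nonempty edge are not disjoint, hence never lie in a common matching.\<close>

definition matching :: "('v, 'e) multi_hypergraph \<Rightarrow> 'e set \<Rightarrow> bool" where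
  "matching H M \<longleftrightarrow> M \<subseteq> edges H \<and> disjoint_family_on (ends H) M"

definition matching_of_size :: "('v, 'e) multi_hypergraph \<Rightarrow> nat \<Rightarrow> 'e set \<Rightarrow> bool" where
  "matching_of_size H n M \<longleftrightarrow> matching H M \<and> finite M \<and> card M = n"

definition color_class :: "('v, 'e) multi_hypergraph \<Rightarrow> ('e \<Rightarrow> nat) \<Rightarrow> nat \<Rightarrow> 'e set" where
  "color_class H c i = {e \<in> edges H. c e = i}"

definition colored :: "nat \<Rightarrow> nat \<Rightarrow> ('v, 'e) multi_hypergraph \<Rightarrow> ('e \<Rightarrow> nat) \<Rightarrow> bool" where
  "colored z t H c \<longleftrightarrow>
     c ` edges H \<subseteq> {1..z} \<and> (\<forall>i\<in>{1..z}. matching_of_size H t (color_class H c i))"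

definition has_rainbow_matching ::
    "('v, 'e) multi_hypergraph \<Rightarrow> ('e \<Rightarrow> nat) \<Rightarrow> nat \<Rightarrow> bool" where
  "has_rainbow_matching H c n \<longleftrightarrow> (\<exists>M. matching_of_size H n M \<and> inj_on c M)"

text \<open>Taking natural numbers as vertices and edge names loses no generality: a \<open>(z,t)\<close>-colored
  \<open>r\<close>-uniform multi-hypergraph has only \<open>z * t\<close> edges, which together cover finitely many vertices,
  and the other vertices play no role.\<close>

definition rainbow_free_numbers :: "nat \<Rightarrow> nat \<Rightarrow> nat set" where
  "rainbow_free_numbers r t =
     {z. \<exists>(H :: (nat, nat) multi_hypergraph) c.
           uniform_multi_hypergraph r H \<and> colored z t H c \<and> \<not> has_rainbow_matching H c t}"

definition F :: "nat \<Rightarrow> nat \<Rightarrow> nat" where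
  "F r t = Max (rainbow_free_numbers r t)"

end

theory Submission
  imports Complex_Main Defs
begin

text \<open>
  Suppose that there are more than \<open>(t - 1) * N\<close> colors, where \<open>N = (r * t) choose r\<close>. Call a set
  \<open>R\<close> of edges representative for a set \<open>E\<close> of edges if every set of \<open>r * (t - 1)\<close> vertices that
  misses some edge of \<open>E\<close> also misses some edge of \<open>R\<close>. For an inclusion-minimal representative \<open>R\<close>,
  each edge \<open>e\<close> of \<open>R\<close> has a set \<open>B e\<close> that misses \<open>e\<close> but meets all other edges of \<open>R\<close>. So the set
  pair inequality of Bollobas applies, and \<open>R\<close> has at most \<open>N\<close> edges
  (\<open>small_representative_subfamily\<close>).

  Take such an \<open>R\<^sub>1\<close> for all edges, discard the at most \<open>N\<close> colors that occur in \<open>R\<^sub>1\<close>, take an \<open>R\<^sub>2\<close>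
  for the edges of the remaining colors, and so on. After \<open>t - 1\<close> rounds at least one color is left.
  Its class is a matching of size \<open>t\<close>, and its edges belonged to the represented family in every
  round. The other \<open>t - 1\<close> edges of a matching cover exactly \<open>r * (t - 1)\<close> vertices, so an edge of the
  matching can be exchanged for an edge of \<open>R\<^bsub>t-1\<^esub>\<close>, then another one for an edge of
  \<open>R\<^bsub>t-2\<^esub>\<close>, down to \<open>R\<^sub>1\<close>. The colors of the \<open>R\<^sub>k\<close> are pairwise disjoint, so each exchange
  brings in a new color, and the final matching is rainbow (\<open>matching_with_many_colors\<close>).
\<close>

section \<open>The set pair inequality\<close>

text \<open>
  This is the local identity behind the averaging proof of the set pair inequality. With
  \<open>a = card A\<close>, \<open>b = card B\<close> and \<open>n = card X\<close>, the \<open>b\<close> points of \<open>B\<close> contribute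
  \<open>b / (a + b - 1 choose a) = (a + b) / (a + b choose a)\<close>, and the \<open>n - a - b\<close> points outside
  \<open>A \<union> B\<close> contribute \<open>1 / (a + b choose a)\<close> each.
\<close>

lemma sum_weight_delete_point:
  fixes A B X :: "'v set"
  assumes X: "finite X" "A \<subseteq> X" "B \<subseteq> X" and disj: "A \<inter> B = {}" and ne: "B \<noteq> {}"
  shows "(\<Sum>x\<in>X - A. 1 / real ((card A + card (B - {x})) choose card A)) =
         real (card X) / real ((card A + card B) choose card A)"
proof -
  define a b where "a = card A" and "b = card B"
  have fin: "finite A" "finite B" using X finite_subset by auto
  have b: "b > 0" using ne fin by (simp add: b_def card_gt_0_iff)
  have split: "X - A = B \<union> (X - (A \<union> B))" "B \<inter> (X - (A \<union> B)) = {}"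
    using X disj by auto
  have card_rest: "real (card (X - (A \<union> B))) = real (card X) - real (a + b)"
  proof -
    have "card (A \<union> B) = a + b"
      using fin disj by (simp add: card_Un_disjoint a_def b_def)
    moreover have "card (A \<union> B) \<le> card X" using X by (intro card_mono) auto
    moreover have "card (X - (A \<union> B)) = card X - card (A \<union> B)"
      using X fin by (intro card_Diff_subset) auto
    ultimately show ?thesis by simp
  qed
  have "b * ((a + b) choose a) = (a + b) * ((a + b - 1) choose a)"
    using binomial_absorb_comp[of "a + b" a] by simp
  then have absorb: "real b * real ((a + b) choose a) = real (a + b) * real ((a + b - 1) choose a)"
    by (metis of_nat_mult)
  have pos: "real ((a + b) choose a) > 0" "real ((a + b - 1) choose a) > 0"
    using b by (auto simp: zero_less_binomial_iff)
  have inside: "(\<Sum>x\<in>B. 1 / real ((a + card (B - {x})) choose a)) =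
      real (a + b) / real ((a + b) choose a)"
  proof -
    have "(\<Sum>x\<in>B. 1 / real ((a + card (B - {x})) choose a)) =
        (\<Sum>x\<in>B. 1 / real ((a + b - 1) choose a))"
      using fin b by (intro sum.cong) (auto simp: b_def)
    also have "\<dots> = real b / real ((a + b - 1) choose a)" by (simp add: b_def)
    also have "\<dots> = real (a + b) / real ((a + b) choose a)"
      using absorb pos by (simp add: frac_eq_eq)
    finally show ?thesis .
  qed
  have outside: "(\<Sum>x\<in>X - (A \<union> B). 1 / real ((a + card (B - {x})) choose a)) =
      (real (card X) - real (a + b)) / real ((a + b) choose a)"
  proof -
    have "(\<Sum>x\<in>X - (A \<union> B). 1 / real ((a + card (B - {x})) choose a)) =
        (\<Sum>x\<in>X - (A \<union> B). 1 / real ((a + b) choose a))"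
      by (intro sum.cong) (auto simp: b_def)
    then show ?thesis by (simp add: card_rest)
  qed
  have "(\<Sum>x\<in>X - A. 1 / real ((a + card (B - {x})) choose a)) =
      (\<Sum>x\<in>B. 1 / real ((a + card (B - {x})) choose a)) +
      (\<Sum>x\<in>X - (A \<union> B). 1 / real ((a + card (B - {x})) choose a))"
    using split X fin by (metis sum.union_disjoint finite_Diff)
  also have "\<dots> = real (card X) / real ((a + b) choose a)"
    unfolding inside outside by (simp add: diff_divide_distrib)
  finally show ?thesis by (simp add: a_def b_def)
qed

text \<open>
  For a point \<open>x\<close>, keep the pairs with \<open>x \<notin> A i\<close> and delete \<open>x\<close> from their \<open>B i\<close>. They are again
  cross-intersecting, on the smaller ground set \<open>X - {x}\<close>, so by induction their total weight is at
  most 1. By the preceding identity, the sum of these total weights over all \<open>x\<close> is \<open>card X\<close> times the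
  original weight.
\<close>

theorem set_pair_inequality:
  fixes A B :: "'i \<Rightarrow> 'v set"
  assumes "finite X" "finite I"
    and "\<And>i. i \<in> I \<Longrightarrow> A i \<subseteq> X \<and> B i \<subseteq> X \<and> A i \<inter> B i = {}"
    and "\<And>i j. i \<in> I \<Longrightarrow> j \<in> I \<Longrightarrow> i \<noteq> j \<Longrightarrow> A i \<inter> B j \<noteq> {}"
  shows "(\<Sum>i\<in>I. 1 / real ((card (A i) + card (B i)) choose card (A i))) \<le> 1"
  using assms
proof (induction "card X" arbitrary: X I B rule: less_induct)
  case less
  show ?case
  proof (cases "\<exists>i\<in>I. B i = {}")
    case True
    \<comment> \<open>Every other \<open>A j\<close> would have to meet the empty set, so this pair is the only one.\<close>
    then obtain i where "i \<in> I" "B i = {}" by blast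
    then have "I = {i}" using less.prems(4) by blast
    then show ?thesis using \<open>B i = {}\<close> by simp
  next
    case False
    define w where "w B' i = 1 / real ((card (A i) + card (B' i)) choose card (A i))"
      for B' :: "'i \<Rightarrow> 'v set" and i
    have IH: "(\<Sum>i\<in>{i \<in> I. x \<notin> A i}. w (\<lambda>i. B i - {x}) i) \<le> 1" if "x \<in> X" for x
      unfolding w_def
    proof (rule less.hyps[of "X - {x}"])
      show "card (X - {x}) < card X" using that less.prems(1) by (intro card_Diff1_less)
      show "finite {i \<in> I. x \<notin> A i}" using less.prems(2) by simp
    next
      fix i assume "i \<in> {i \<in> I. x \<notin> A i}"
      then show "A i \<subseteq> X - {x} \<and> B i - {x} \<subseteq> X - {x} \<and> A i \<inter> (B i - {x}) = {}"
        using less.prems(3)[of i] by auto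
    next
      fix i j assume "i \<in> {i \<in> I. x \<notin> A i}" "j \<in> {i \<in> I. x \<notin> A i}" "i \<noteq> j"
      then show "A i \<inter> (B j - {x}) \<noteq> {}" using less.prems(4)[of i j] by auto
    qed (use less.prems(1) in simp)
    have "real (card X) * (\<Sum>i\<in>I. w B i) = (\<Sum>i\<in>I. \<Sum>x\<in>X - A i. w (\<lambda>i. B i - {x}) i)"
    proof -
      have "real (card X) * w B i = (\<Sum>x\<in>X - A i. w (\<lambda>i. B i - {x}) i)" if "i \<in> I" for i
        unfolding w_def using sum_weight_delete_point[of X "A i" "B i"] less.prems(1,3) that False
        by auto
      then show ?thesis by (simp add: sum_distrib_left)
    qed
    also have "\<dots> = (\<Sum>i\<in>I. \<Sum>x\<in>{x \<in> X. x \<notin> A i}. w (\<lambda>i. B i - {x}) i)"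
      by (simp add: set_diff_eq)
    also have "\<dots> = (\<Sum>x\<in>X. \<Sum>i\<in>{i \<in> I. x \<notin> A i}. w (\<lambda>i. B i - {x}) i)"
      using less.prems(1,2) by (rule sum.swap_restrict[OF _ , rotated])
    also have "\<dots> \<le> (\<Sum>x\<in>X. 1)" using IH by (intro sum_mono)
    finally have bound: "real (card X) * (\<Sum>i\<in>I. w B i) \<le> real (card X)" by simp
    show ?thesis
    proof (cases "I = {}")
      case False
      then have "X \<noteq> {}" using \<open>\<not> (\<exists>i\<in>I. B i = {})\<close> less.prems(3) by fastforce
      then have "real (card X) > 0" using less.prems(1) by (simp add: card_gt_0_iff)
      then show ?thesis using bound by (simp add: w_def)
    qed simp
  qed
qed

corollary set_pair_bound:
  fixes A B :: "'i \<Rightarrow> 'v set"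
  assumes "finite I"
    and size: "\<And>i. i \<in> I \<Longrightarrow> finite (A i) \<and> finite (B i) \<and> card (A i) = a \<and> card (B i) = b"
    and "\<And>i. i \<in> I \<Longrightarrow> A i \<inter> B i = {}"
    and "\<And>i j. i \<in> I \<Longrightarrow> j \<in> I \<Longrightarrow> i \<noteq> j \<Longrightarrow> A i \<inter> B j \<noteq> {}"
  shows "card I \<le> (a + b) choose a"
proof -
  have "(\<Sum>i\<in>I. 1 / real ((card (A i) + card (B i)) choose card (A i))) \<le> 1"
    by (rule set_pair_inequality[where X = "\<Union>i\<in>I. A i \<union> B i"]) (use assms in auto)
  then have "real (card I) / real ((a + b) choose a) \<le> 1" using size by simp
  moreover have "real ((a + b) choose a) > 0" by (simp add: zero_less_binomial_iff)
  ultimately have "real (card I) \<le> real ((a + b) choose a)" by (simp add: pos_divide_le_eq)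
  then show ?thesis by linarith
qed

section \<open>Representative subfamilies\<close>

text \<open>
  Take an inclusion-minimal representative subfamily \<open>R\<close>. Removing any \<open>e\<close> destroys the property, and
  a set \<open>B e\<close> that witnesses this is missed by \<open>e\<close> alone among \<open>R\<close>. The pairs \<open>(S e, B e)\<close> are
  cross-intersecting.
\<close>

lemma small_representative_subfamily:
  fixes S :: "'e \<Rightarrow> 'v set"
  assumes "finite E" and S: "\<And>e. e \<in> E \<Longrightarrow> finite (S e) \<and> card (S e) = r"
  obtains R where "R \<subseteq> E" "card R \<le> (r + b) choose r"
    "\<And>B e. finite B \<Longrightarrow> card B = b \<Longrightarrow> e \<in> E \<Longrightarrow> S e \<inter> B = {} \<Longrightarrow> \<exists>f\<in>R. S f \<inter> B = {}"
proof -
  define represents where "represents R \<longleftrightarrow>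
    (\<forall>B e. finite B \<and> card B = b \<and> e \<in> E \<and> S e \<inter> B = {} \<longrightarrow> (\<exists>f\<in>R. S f \<inter> B = {}))" for R
  define \<R> where "\<R> = {R. R \<subseteq> E \<and> represents R}"
  have "E \<in> \<R>" by (auto simp: \<R>_def represents_def)
  then have "\<R> \<noteq> {}" by blast
  moreover have "finite \<R>" using \<open>finite E\<close> by (simp add: \<R>_def)
  ultimately obtain R where R_in: "R \<in> \<R>" and min: "\<forall>Q\<in>\<R>. Q \<le> R \<longrightarrow> R = Q"
    using finite_has_minimal[of \<R>] by meson
  have R: "R \<subseteq> E" "represents R" using R_in by (auto simp: \<R>_def)
  have minimal: "R = Q" if "Q \<subseteq> E" "represents Q" "Q \<subseteq> R" for Q
    using min that by (simp add: \<R>_def)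
  have "\<exists>B. finite B \<and> card B = b \<and> S e \<inter> B = {} \<and> (\<forall>f\<in>R - {e}. S f \<inter> B \<noteq> {})" if "e \<in> R" for e
  proof -
    have "\<not> represents (R - {e})" using minimal[of "R - {e}"] R(1) that by blast
    then obtain B g where B: "finite B" "card B = b" "g \<in> E" "S g \<inter> B = {}"
      and miss: "\<forall>f\<in>R - {e}. S f \<inter> B \<noteq> {}"
      unfolding represents_def by blast
    then obtain f where "f \<in> R" "S f \<inter> B = {}" using R(2) unfolding represents_def by blast
    then have "S e \<inter> B = {}" using miss by blast
    then show ?thesis using B miss by blast
  qed
  then obtain B where B: "\<And>e. e \<in> R \<Longrightarrow> finite (B e) \<and> card (B e) = b \<and> S e \<inter> B e = {}"
    "\<And>e f. e \<in> R \<Longrightarrow> f \<in> R - {e} \<Longrightarrow> S f \<inter> B e \<noteq> {}"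
    by metis
  have "card R \<le> (r + b) choose r"
  proof (rule set_pair_bound[where A = S and B = B])
    show "finite R" using R(1) \<open>finite E\<close> finite_subset by blast
  qed (use B S R(1) in auto)
  then show thesis using that[OF R(1)] R(2) unfolding represents_def by blast
qed

section \<open>Exchanging edges for new colors\<close>

lemma card_Union_ends_matching:
  assumes "uniform_multi_hypergraph r H" "matching_of_size H n M"
  shows "finite (\<Union>(ends H ` M))" "card (\<Union>(ends H ` M)) = r * n"
proof -
  have M: "finite M" "card M = n" "M \<subseteq> edges H" "disjoint_family_on (ends H) M"
    using assms(2) by (auto simp: matching_of_size_def matching_def)
  have ends: "finite (ends H e)" "card (ends H e) = r" if "e \<in> M" for e
    using assms(1) M(3) that by (auto simp: uniform_multi_hypergraph_def)
  show "finite (\<Union>(ends H ` M))" using M ends by auto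
  have "card (\<Union>(ends H ` M)) = (\<Sum>e\<in>M. card (ends H e))"
    by (rule card_UN_disjoint) (use M ends in \<open>auto simp: disjoint_family_on_def\<close>)
  then show "card (\<Union>(ends H ` M)) = r * n" using ends M by (simp add: mult.commute)
qed

lemma matching_exchange:
  assumes M: "matching_of_size H n M" "e \<in> M"
    and f: "f \<in> edges H" "f \<notin> M" "ends H f \<inter> \<Union>(ends H ` (M - {e})) = {}"
  shows "matching_of_size H n (insert f (M - {e}))"
proof -
  have "card (insert f (M - {e})) = card M"
    using M f(2) card_Suc_Diff1[of M e] by (simp add: matching_of_size_def)
  then show ?thesis
    using M f(1,3) unfolding matching_of_size_def matching_def disjoint_family_on_def
    by (auto simp: Int_commute)
qed

text \<open>
  The induction removes the colors \<open>c ` R\<close> of a representative subfamily \<open>R\<close>. A matching in the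
  remaining colors either has enough colors already or has a repeated one; in the latter case an edge
  of a repeated color can go without losing that color, and its replacement from \<open>R\<close> has a color that
  the remaining edges cannot have.
\<close>

lemma matching_with_many_colors:
  assumes H: "uniform_multi_hypergraph r H" and fin: "finite (edges H)"
    and Z: "finite Z" "\<And>i. i \<in> Z \<Longrightarrow> matching_of_size H t (color_class H c i)"
    and "k < t" and "card Z > k * ((r * t) choose r)"
  shows "\<exists>M. matching_of_size H t M \<and> c ` M \<subseteq> Z \<and> card (c ` M) > k"
  using Z \<open>k < t\<close> \<open>card Z > k * ((r * t) choose r)\<close>
proof (induction k arbitrary: Z)
  case 0
  then obtain i where i: "i \<in> Z" by fastforce
  then have m: "matching_of_size H t (color_class H c i)" using 0 by blast
  then have "color_class H c i \<noteq> {}" using 0 by (auto simp: matching_of_size_def)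
  then have "c ` color_class H c i = {i}" by (auto simp: color_class_def)
  then show ?case using m i by (intro exI[of _ "color_class H c i"]) auto
next
  case (Suc k)
  define E where "E = {e \<in> edges H. c e \<in> Z}"
  have t: "r + r * (t - 1) = r * t" using Suc.prems(3) by (cases t) auto
  have E: "finite E" "\<And>e. e \<in> E \<Longrightarrow> finite (ends H e) \<and> card (ends H e) = r"
    using fin H by (auto simp: E_def uniform_multi_hypergraph_def)
  obtain R where R: "R \<subseteq> E" "card R \<le> (r * t) choose r"
    and represents: "\<And>B e. finite B \<Longrightarrow> card B = r * (t - 1) \<Longrightarrow> e \<in> E \<Longrightarrow> ends H e \<inter> B = {} \<Longrightarrow>
      \<exists>f\<in>R. ends H f \<inter> B = {}"
    by (rule small_representative_subfamily[OF E, where b = "r * (t - 1)", unfolded t])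
      (assumption | rule that)+
  have "finite R" using R(1) E(1) finite_subset by blast
  then have "card (c ` R) \<le> (r * t) choose r" using card_image_le R(2) le_trans by blast
  then have "k * ((r * t) choose r) < card (Z - c ` R)"
    using Suc.prems(4) diff_card_le_card_Diff[of "c ` R" Z] \<open>finite R\<close> by simp
  then obtain M where M: "matching_of_size H t M" "c ` M \<subseteq> Z - c ` R" "card (c ` M) > k"
    using Suc.IH[of "Z - c ` R"] Suc.prems by auto
  show ?case
  proof (cases "card (c ` M) > Suc k")
    case True
    then show ?thesis using M by blast
  next
    case False
    have finM: "finite M" "card M = t" "M \<subseteq> edges H" "disjoint_family_on (ends H) M"
      using M(1) by (auto simp: matching_of_size_def matching_def)
    have "\<not> inj_on c M" using False Suc.prems(3) finM card_image[of c M] by auto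
    then obtain e e' where e: "e \<in> M" "e' \<in> M" "e \<noteq> e'" "c e = c e'" by (auto simp: inj_on_def)
    have same: "c ` (M - {e}) = c ` M" using e by (auto simp: image_iff)
    have "matching_of_size H (t - 1) (M - {e})"
      using finM e(1) by (auto simp: matching_of_size_def matching_def disjoint_family_on_def)
    note cover = card_Union_ends_matching[OF H this]
    have "e \<in> E" using e(1) finM(3) M(2) by (auto simp: E_def)
    moreover have "ends H e \<inter> \<Union>(ends H ` (M - {e})) = {}"
      using finM(4) e(1) by (auto simp: disjoint_family_on_def)
    ultimately obtain f where f: "f \<in> R" "ends H f \<inter> \<Union>(ends H ` (M - {e})) = {}"
      using represents[OF cover] by blast
    have new: "c f \<notin> c ` M" using f(1) M(2) by blast
    have "matching_of_size H t (insert f (M - {e}))"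
      by (rule matching_exchange[OF M(1) e(1)]) (use f new R(1) in \<open>auto simp: E_def\<close>)
    moreover have "c ` insert f (M - {e}) \<subseteq> Z"
      using M(2) f(1) R(1) by (auto simp: E_def)
    moreover have "card (c ` insert f (M - {e})) > Suc k"
      using same new M(3) finM(1) by simp
    ultimately show ?thesis by blast
  qed
qed

theorem rainbow_matching_if_many_colors:
  assumes H: "uniform_multi_hypergraph r H" and col: "colored z t H c"
    and "t > 0" and "z > (t - 1) * ((r * t) choose r)"
  shows "has_rainbow_matching H c t"
proof -
  have classes: "\<And>i. i \<in> {1..z} \<Longrightarrow> matching_of_size H t (color_class H c i)"
    and range: "c ` edges H \<subseteq> {1..z}"
    using col by (auto simp: colored_def)
  have "edges H = (\<Union>i\<in>{1..z}. color_class H c i)" using range by (auto simp: color_class_def)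
  then have "finite (edges H)" using classes by (auto simp: matching_of_size_def)
  then obtain M where M: "matching_of_size H t M" "card (c ` M) > t - 1"
    using matching_with_many_colors[OF H _ finite_atLeastAtMost[of 1 z] classes, where k = "t - 1"]
      assms(3,4)
    by auto
  then have "finite M" "card (c ` M) \<ge> card M" by (auto simp: matching_of_size_def)
  then have "inj_on c M" by (intro eq_card_imp_inj_on) (auto intro: antisym card_image_le)
  then show ?thesis using M(1) by (auto simp: has_rainbow_matching_def)
qed

theorem theorem9:
  fixes r t :: nat
  assumes "r > 0" and "t > 0"
  shows "finite (rainbow_free_numbers r t) \<and> rainbow_free_numbers r t \<noteq> {} \<and>
    F r t \<le> (t - 1) * ((r * t) choose r) \<and>
    (\<forall>(H :: ('v, 'e) multi_hypergraph) c z.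
       uniform_multi_hypergraph r H \<and> colored z t H c \<and> z > (t - 1) * ((r * t) choose r) \<longrightarrow>
       has_rainbow_matching H c t)"
proof -
  have sub: "rainbow_free_numbers r t \<subseteq> {..(t - 1) * ((r * t) choose r)}"
    using rainbow_matching_if_many_colors[OF _ _ assms(2)]
    by (force simp: rainbow_free_numbers_def not_less[symmetric])
  then have fin: "finite (rainbow_free_numbers r t)" using finite_subset by blast
  \<comment> \<open>The hypergraph without edges shows that \<open>0\<close> is attained.\<close>
  define H\<^sub>0 :: "(nat, nat) multi_hypergraph" where
    "H\<^sub>0 = \<lparr>verts = {}, edges = {}, ends = (\<lambda>_. {})\<rparr>"
  have "uniform_multi_hypergraph r H\<^sub>0" "colored 0 t H\<^sub>0 (\<lambda>_. 0)"
    by (auto simp: H\<^sub>0_def uniform_multi_hypergraph_def colored_def)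
  moreover have "\<not> has_rainbow_matching H\<^sub>0 (\<lambda>_. 0) t"
    using assms(2) by (auto simp: H\<^sub>0_def has_rainbow_matching_def matching_of_size_def matching_def)
  ultimately have "0 \<in> rainbow_free_numbers r t" by (auto simp: rainbow_free_numbers_def)
  then have ne: "rainbow_free_numbers r t \<noteq> {}" by blast
  have "F r t \<le> (t - 1) * ((r * t) choose r)"
    using Max_in[OF fin ne] sub by (auto simp: F_def)
  then show ?thesis
    using fin ne rainbow_matching_if_many_colors[OF _ _ assms(2)] by blast
qed

end
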